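(* Let $j\geq \chi\geq 2$ and $n\geq 2$ be integers. If $H$ is a graph with chromatic number $\chi$ and $G$ is a connected graph on $n$ vertices, then \[ m_j(H,G)\geq \Big\lfloor \frac{n-1}{\lceil \frac{j}{\chi-1}\rceil}\Big\rfloor+1 . \]
   Context: All graphs are simple. For integers $j\geq 2$ and $t\geq 1$, $K_{j\times t}$ denotes the complete multipartite graph with $j$ parts, each of size $t$. For graphs $H$ and $G$, the size multipartite Ramsey number $m_j(H,G)$ is the smallest natural number $t$ such that every coloring of the edges of $K_{j\times t}$ with two colors red and blue contains a red copy of $H$ or a blue copy of $G$ as a subgraph. *)

theory Defs
  imports
    Complex_Main
    "HOL-Library.Extended_Nat"
    "Graph_Theory.Graph_Theory"
begin

text \<open>
  Finite simple graphs are the symmetric loop-free digraphs of the locale \<open>pair_graph\<close>: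
  an undirected edge \<open>{u, v}\<close> is the pair of arcs \<open>(u, v)\<close> and \<open>(v, u)\<close>.
\<close>

definition proper_coloring :: "'a pair_pre_digraph \<Rightarrow> nat \<Rightarrow> ('a \<Rightarrow> nat) \<Rightarrow> bool" where
  "proper_coloring G k c \<longleftrightarrow>
     (\<forall>v \<in> pverts G. c v < k) \<and> (\<forall>(u, v) \<in> parcs G. c u \<noteq> c v)"

definition chromatic_number :: "'a pair_pre_digraph \<Rightarrow> nat" where
  "chromatic_number G = (LEAST k. \<exists>c. proper_coloring G k c)"

text \<open>The vertex \<open>(i, a)\<close> is the \<open>a\<close>-th vertex of the \<open>i\<close>-th part.\<close>

definition complete_multipartite :: "nat \<Rightarrow> nat \<Rightarrow> (nat \<times> nat) pair_pre_digraph" where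
  "complete_multipartite j t =
     \<lparr> pverts = {..<j} \<times> {..<t},
       parcs = {(u, v). u \<in> {..<j} \<times> {..<t} \<and> v \<in> {..<j} \<times> {..<t} \<and> fst u \<noteq> fst v} \<rparr>"

datatype color = Red | Blue

text \<open>
  An edge coloring is a function on undirected edges \<open>{u, v}\<close>, so both arcs of an edge
  automatically receive the same color; its values on other sets are irrelevant.
\<close>

definition color_class ::
    "'v pair_pre_digraph \<Rightarrow> ('v set \<Rightarrow> color) \<Rightarrow> color \<Rightarrow> 'v pair_pre_digraph" where
  "color_class K c x =
     \<lparr> pverts = pverts K, parcs = {(u, v). (u, v) \<in> parcs K \<and> c {u, v} = x} \<rparr>"

text \<open>A copy of \<open>H\<close> as a not necessarily induced subgraph.\<close>

definition contains_copy :: "'v pair_pre_digraph \<Rightarrow> 'a pair_pre_digraph \<Rightarrow> bool" where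
  "contains_copy K H \<longleftrightarrow>
     (\<exists>f. inj_on f (pverts H) \<and> f ` pverts H \<subseteq> pverts K \<and>
          (\<forall>(u, v) \<in> parcs H. (f u, f v) \<in> parcs K))"

definition multipartite_arrows ::
    "nat \<Rightarrow> nat \<Rightarrow> 'a pair_pre_digraph \<Rightarrow> 'b pair_pre_digraph \<Rightarrow> bool" where
  "multipartite_arrows j t H G \<longleftrightarrow>
     (\<forall>c. contains_copy (color_class (complete_multipartite j t) c Red) H \<or>
          contains_copy (color_class (complete_multipartite j t) c Blue) G)"

text \<open>
  The value is \<open>\<infinity>\<close> if no \<open>t\<close> has the required property; this does happen, e.g. for \<open>j = 2\<close>,
  \<open>H\<close> a single edge and \<open>G\<close> a triangle.
\<close>

definition size_multipartite_ramsey ::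
    "nat \<Rightarrow> 'a pair_pre_digraph \<Rightarrow> 'b pair_pre_digraph \<Rightarrow> enat" where
  "size_multipartite_ramsey j H G = (INF t \<in> {t. 1 \<le> t \<and> multipartite_arrows j t H G}. enat t)"

end

theory Submission
  imports Defs
begin

text \<open>
  Let \<open>q = \<lceil>j / (\<chi> - 1)\<rceil>\<close> and group the \<open>j\<close> parts into at most \<open>\<chi> - 1\<close> blocks of at most \<open>q\<close>
  consecutive parts. Color an edge blue if it stays inside a block and red otherwise. The red graph
  is \<open>(\<chi> - 1)\<close>-colorable by blocks, hence has no copy of \<open>H\<close>. A blue copy of the connected graph
  \<open>G\<close> lies inside one block, which has at most \<open>q t\<close> vertices, so \<open>n \<le> q t\<close>.
\<close>

lemma chromatic_number_le: "proper_coloring G k c \<Longrightarrow> chromatic_number G \<le> k"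
  unfolding chromatic_number_def by (rule Least_le) blast

lemma proper_coloring_comp_copy:
  assumes "f ` pverts H \<subseteq> pverts K" and "\<forall>(u, v) \<in> parcs H. (f u, f v) \<in> parcs K"
    and "proper_coloring K k c"
  shows "proper_coloring H k (c \<circ> f)"
  using assms unfolding proper_coloring_def by fastforce

lemma contains_copy_chromatic_number_le:
  assumes "contains_copy K H" and "proper_coloring K k c"
  shows "chromatic_number H \<le> k"
  using assms proper_coloring_comp_copy chromatic_number_le unfolding contains_copy_def by metis

text \<open>Since the arcs are symmetric, connectedness yields a directed walk from \<open>x\<close>
  to \<open>y\<close>; induction along it keeps \<open>h\<close> constant.\<close>

lemma connected_arc_invariant_eq:
  assumes "pair_graph G" and "connected (with_proj G)"
    and inv: "\<And>u v. (u, v) \<in> parcs G \<Longrightarrow> h u = h v"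
    and "x \<in> pverts G" and "y \<in> pverts G"
  shows "h x = h y"
proof -
  interpret pair_graph G by fact
  have "x \<rightarrow>\<^sup>*\<^bsub>with_proj G\<^esub> y"
    using assms(2,4,5) reachable_mk_symmetric_eq[OF sym_arcs]
    by (auto simp: connected_def strongly_connected_def)
  then show ?thesis
    by (induction rule: reachable_induct) (auto dest: inv)
qed

text \<open>Part \<open>i\<close> belongs to block \<open>i div q\<close>. The argument is a set
  because colorings act on undirected edges.\<close>

definition block_coloring :: "nat \<Rightarrow> (nat \<times> nat) set \<Rightarrow> color" where
  "block_coloring q e = (if \<exists>b. \<forall>v\<in>e. fst v div q = b then Blue else Red)"

lemma block_coloring_pair:
  "block_coloring q {u, v} = (if fst u div q = fst v div q then Blue else Red)"
  by (auto simp: block_coloring_def)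

lemma proper_coloring_red_block_coloring:
  assumes "j \<le> q * k"
  shows "proper_coloring (color_class (complete_multipartite j t) (block_coloring q) Red) k
    (\<lambda>v. fst v div q)"
proof -
  have "i div q < k" if "i < j" for i
    using that assms by (metis less_mult_imp_div_less mult.commute order_less_le_trans)
  then show ?thesis
    by (auto simp: proper_coloring_def color_class_def complete_multipartite_def
        block_coloring_pair)
qed

text \<open>Blue arcs preserve the block index, so connectedness of \<open>G\<close> confines its
  copy to a single block.\<close>

lemma card_le_of_blue_block_copy:
  assumes "pair_graph G" and "connected (with_proj G)" and "q > 0"
    and "contains_copy (color_class (complete_multipartite j t) (block_coloring q) Blue) G"
  shows "card (pverts G) \<le> q * t"
proof -
  obtain f where f: "inj_on f (pverts G)" "f ` pverts G \<subseteq> {..<j} \<times> {..<t}"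
    and arcs: "\<And>u v. (u, v) \<in> parcs G \<Longrightarrow> fst (f u) div q = fst (f v) div q"
    using assms(4)
    by (fastforce simp: contains_copy_def color_class_def complete_multipartite_def
        block_coloring_pair split: if_splits)
  have same_block: "fst (f u) div q = fst (f v) div q"
    if "u \<in> pverts G" "v \<in> pverts G" for u v
    using connected_arc_invariant_eq[OF assms(1,2), where h = "\<lambda>v. fst (f v) div q"] arcs that
    by blast
  obtain b where b: "\<And>v. v \<in> pverts G \<Longrightarrow> fst (f v) div q = b"
    using same_block by metis
  \<comment> \<open>The last block may be cut short by \<open>j\<close>; the full interval of
    \<open>q\<close> parts still bounds it from above.\<close>
  have "f ` pverts G \<subseteq> {b * q..<b * q + q} \<times> {..<t}"
  proof
    fix w assume w: "w \<in> f ` pverts G"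
    then have "fst w div q = b" using b by auto
    then have "b * q \<le> fst w" "fst w < b * q + q"
      using \<open>q > 0\<close> by (auto simp: dividend_less_div_times add.commute)
    then show "w \<in> {b * q..<b * q + q} \<times> {..<t}"
      using w f(2) by (cases w) auto
  qed
  then have "card (f ` pverts G) \<le> card ({b * q..<b * q + q} \<times> {..<t})"
    by (intro card_mono) auto
  then show ?thesis using f(1) by (simp add: card_image)
qed

text \<open>Apply the arrowing property to \<open>block_coloring q\<close>: a red copy of
  \<open>H\<close> would force its chromatic number to be at most \<open>k\<close>, so there is a
  blue copy of \<open>G\<close>.\<close>

lemma multipartite_arrows_card_le:
  assumes "pair_graph G" and "connected (with_proj G)" and "q > 0"
    and "j \<le> q * k" and "k < chromatic_number H" and "multipartite_arrows j t H G"
  shows "card (pverts G) \<le> q * t"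
  using assms card_le_of_blue_block_copy proper_coloring_red_block_coloring
    contains_copy_chromatic_number_le leD unfolding multipartite_arrows_def by metis

theorem theorem2:
  fixes j \<chi> n :: nat
    and H :: "'a pair_pre_digraph" and G :: "'b pair_pre_digraph"
  assumes "j \<ge> \<chi>" and "\<chi> \<ge> 2" and "n \<ge> 2"
    and "pair_graph H" and "chromatic_number H = \<chi>"
    and "pair_graph G" and "connected (with_proj G)" and "card (pverts G) = n"
  shows "size_multipartite_ramsey j H G
    \<ge> enat (nat (\<lfloor>(real n - 1) / of_int \<lceil>real j / (real \<chi> - 1)\<rceil>\<rfloor> + 1))"
proof -
  define q where "q = nat \<lceil>real j / (real \<chi> - 1)\<rceil>"
  \<comment> \<open>Positivity ensures that \<open>nat\<close> does not truncate the ceiling and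
    that \<open>q\<close> is a valid block length.\<close>
  have "real j / (real \<chi> - 1) > 0" using assms(1,2) by simp
  then have q: "\<lceil>real j / (real \<chi> - 1)\<rceil> = int q" and "q > 0"
    unfolding q_def by auto
  have "real j / (real \<chi> - 1) \<le> real q" using q by linarith
  then have "real j \<le> real q * real (\<chi> - 1)"
    using assms(2) by (simp add: divide_le_eq of_nat_diff)
  then have j: "j \<le> q * (\<chi> - 1)" by (metis of_nat_le_iff of_nat_mult)
  have "nat (\<lfloor>(real n - 1) / real q\<rfloor> + 1) \<le> t" if "multipartite_arrows j t H G" for t
  proof -
    have "n \<le> q * t"
      using multipartite_arrows_card_le[OF assms(6,7) \<open>q > 0\<close> j _ that] assms(2,5,8) by simp
    then have "real n \<le> real t * real q" by (metis mult.commute of_nat_le_iff of_nat_mult)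
    \<comment> \<open>Subtracting 1 makes the inequality strict, so the floor is below
      \<open>t\<close> and the \<open>+ 1\<close> is gained.\<close>
    then have "(real n - 1) / real q < real t" using \<open>q > 0\<close> by (simp add: divide_less_eq)
    then show ?thesis by linarith
  qed
  then show ?thesis
    unfolding size_multipartite_ramsey_def q by (intro INF_greatest) simp
qed

end
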